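(* Let $R$ be a ring. Then the following are equivalent: (1) $R$ is a uniquely nil-clean ring. (2) $R$ is a semipotent CUNC-ring. (3) $R$ is abelian, $J(R)$ is nil and $R/J(R)$ is boolean.
   Context: All rings are associative with identity (not necessarily commutative). $U(R)$, $J(R)$, $\mathrm{nil}(R)$, $\mathrm{idem}(R)$ denote the group of units, the Jacobson radical, the set of nilpotents and the set of idempotents of $R$. An element $r\in R$ is clean if $r=u+e$ for some $u\in U(R)$ and $e\in\mathrm{idem}(R)$. An element $r\in R$ is uniquely nil-clean if there is exactly one pair $(q,e)\in\mathrm{nil}(R)\times\mathrm{idem}(R)$ with $r=q+e$. $R$ is a uniquely nil-clean ring if every element of $R$ is uniquely nil-clean. $R$ is a CUNC-ring if every clean element of $R$ is uniquely nil-clean. $R$ is semipotent if every one-sided ideal of $R$ not contained in $J(R)$ contains a non-zero idempotent. $R$ is abelian if all its idempotents are central. A ring is boolean if all its elements are idempotent. An ideal is nil if all its elements are nilpotent. *)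

theory Defs
  imports "HOL-Algebra.QuotRing"
begin

text \<open>
  Rings are the unital, not necessarily commutative rings of the locale \<^locale>\<open>ring\<close>;
  the zero ring is allowed. The locale \<^locale>\<open>ideal\<close> is about two-sided ideals, so
  one-sided ideals are introduced here.
\<close>

definition left_ideal :: "'a set \<Rightarrow> ('a, 'b) ring_scheme \<Rightarrow> bool" where
  "left_ideal I R \<longleftrightarrow>
     additive_subgroup I R \<and> (\<forall>a \<in> I. \<forall>x \<in> carrier R. x \<otimes>\<^bsub>R\<^esub> a \<in> I)"

definition right_ideal :: "'a set \<Rightarrow> ('a, 'b) ring_scheme \<Rightarrow> bool" where
  "right_ideal I R \<longleftrightarrow>
     additive_subgroup I R \<and> (\<forall>a \<in> I. \<forall>x \<in> carrier R. a \<otimes>\<^bsub>R\<^esub> x \<in> I)"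

definition maximal_left_ideal :: "'a set \<Rightarrow> ('a, 'b) ring_scheme \<Rightarrow> bool" where
  "maximal_left_ideal M R \<longleftrightarrow>
     left_ideal M R \<and> M \<noteq> carrier R \<and>
     (\<forall>I. left_ideal I R \<and> M \<subseteq> I \<longrightarrow> I = M \<or> I = carrier R)"

text \<open>
  The Jacobson radical is the intersection of all maximal left ideals, formed inside the carrier;
  for the zero ring, which has no maximal left ideals, this is the whole ring.
\<close>

definition jacobson_radical :: "('a, 'b) ring_scheme \<Rightarrow> 'a set" where
  "jacobson_radical R = {x \<in> carrier R. \<forall>M. maximal_left_ideal M R \<longrightarrow> x \<in> M}"

definition nilpotents :: "('a, 'b) ring_scheme \<Rightarrow> 'a set" where
  "nilpotents R = {x \<in> carrier R. \<exists>n::nat. x [^]\<^bsub>R\<^esub> n = \<zero>\<^bsub>R\<^esub>}"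

definition idempotents :: "('a, 'b) ring_scheme \<Rightarrow> 'a set" where
  "idempotents R = {x \<in> carrier R. x \<otimes>\<^bsub>R\<^esub> x = x}"

definition clean_element :: "('a, 'b) ring_scheme \<Rightarrow> 'a \<Rightarrow> bool" where
  "clean_element R r \<longleftrightarrow> (\<exists>u \<in> Units R. \<exists>e \<in> idempotents R. r = u \<oplus>\<^bsub>R\<^esub> e)"

definition uniquely_nil_clean_element :: "('a, 'b) ring_scheme \<Rightarrow> 'a \<Rightarrow> bool" where
  "uniquely_nil_clean_element R r \<longleftrightarrow>
     (\<exists>!p. p \<in> nilpotents R \<times> idempotents R \<and> r = fst p \<oplus>\<^bsub>R\<^esub> snd p)"

definition uniquely_nil_clean_ring :: "('a, 'b) ring_scheme \<Rightarrow> bool" where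
  "uniquely_nil_clean_ring R \<longleftrightarrow> (\<forall>r \<in> carrier R. uniquely_nil_clean_element R r)"

definition CUNC_ring :: "('a, 'b) ring_scheme \<Rightarrow> bool" where
  "CUNC_ring R \<longleftrightarrow>
     (\<forall>r \<in> carrier R. clean_element R r \<longrightarrow> uniquely_nil_clean_element R r)"

definition semipotent_ring :: "('a, 'b) ring_scheme \<Rightarrow> bool" where
  "semipotent_ring R \<longleftrightarrow>
     (\<forall>I. (left_ideal I R \<or> right_ideal I R) \<and> \<not> I \<subseteq> jacobson_radical R \<longrightarrow>
          (\<exists>e \<in> I. e \<in> idempotents R \<and> e \<noteq> \<zero>\<^bsub>R\<^esub>))"

text \<open>
  \<open>Abelian\<close> concerns central idempotents; it is unrelated to \<^locale>\<open>abelian_group\<close>.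
\<close>

definition abelian_ring :: "('a, 'b) ring_scheme \<Rightarrow> bool" where
  "abelian_ring R \<longleftrightarrow>
     (\<forall>e \<in> idempotents R. \<forall>x \<in> carrier R. e \<otimes>\<^bsub>R\<^esub> x = x \<otimes>\<^bsub>R\<^esub> e)"

definition boolean_ring :: "('a, 'b) ring_scheme \<Rightarrow> bool" where
  "boolean_ring R \<longleftrightarrow> ring R \<and> (\<forall>x \<in> carrier R. x \<in> idempotents R)"

definition nil_ideal :: "'a set \<Rightarrow> ('a, 'b) ring_scheme \<Rightarrow> bool" where
  "nil_ideal I R \<longleftrightarrow> ideal I R \<and> (\<forall>x \<in> I. x \<in> nilpotents R)"

end

theory Submission
  imports Defs
begin

text \<open>
  The implications are shown in the order (1), (2), (3), (1). In a CUNC-ring, idempotents and units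
  are clean; uniqueness at the idempotents makes the ring abelian, and at the units it makes every
  unit the sum of 1 and a nilpotent, so that \<open>J(R)\<close> is nil. Semipotence then provides central
  idempotents \<open>e\<close>, and everything else comes from the fact that a nilpotent element is not
  invertible in a non-zero corner ring \<open>eR\<close>. For (1) from (3), idempotents are lifted modulo the
  nil ideal \<open>J(R)\<close>.
\<close>

text \<open>Uniqueness of nil-clean decompositions acts through centrality of idempotents, and
  centrality in turn forces uniqueness. For central \<open>e\<close> the map sending
  \<open>x\<close> to \<open>xe\<close> is a ring homomorphism onto the corner \<open>eR\<close>,
  whose identity is \<open>e\<close>; it takes nilpotents to nilpotents, and \<open>1\<close> is the
  only obstruction: a nilpotent with a left inverse in \<open>eR\<close> gives \<open>e = 0\<close>.
  Each use of this exhibits such an inverse. The obstacle is one of sides. The radical is defined by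
  maximal left ideals, while semipotence also speaks of right ideals and the quotient needs a
  two-sided ideal. Left invertibility of all \<open>1 - sx\<close> characterises membership of
  \<open>x\<close> in the radical, and it changes sides because \<open>1 - ab\<close> and
  \<open>1 - ba\<close> are left invertible together.\<close>

context ring
begin

text \<open>The rules of \<open>algebra\<close> for non-commutative rings lack \<open>r_one\<close>.\<close>

lemmas [algebra del: ring "zero R" "add R" "a_inv R" "a_minus R" "one R" "mult R"] = _

lemmas [algebra ring "zero R" "add R" "a_inv R" "a_minus R" "one R" "mult R"] =
  ring_simprules r_one

lemma eq_if_minus_eq_zero:
  assumes "a \<in> carrier R" "b \<in> carrier R" "a \<ominus> b = \<zero>"
  shows "a = b"
proof -
  have "a = (a \<ominus> b) \<oplus> b" using assms(1,2) by algebra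
  then show ?thesis using assms by simp
qed

section \<open>Left ideals and the existence of maximal ones\<close>

lemma left_idealI:
  assumes "I \<subseteq> carrier R" "\<zero> \<in> I"
    and "\<And>a b. a \<in> I \<Longrightarrow> b \<in> I \<Longrightarrow> a \<oplus> b \<in> I"
    and "\<And>a x. a \<in> I \<Longrightarrow> x \<in> carrier R \<Longrightarrow> x \<otimes> a \<in> I"
  shows "left_ideal I R"
proof -
  have "\<ominus> a \<in> I" if "a \<in> I" for a
  proof -
    have "a \<in> carrier R" using that assms(1) by auto
    then have "\<ominus> a = (\<ominus> \<one>) \<otimes> a" by algebra
    then show ?thesis using assms(4)[OF that, of "\<ominus> \<one>"] by simp
  qed
  then have "subgroup I (add_monoid R)"
    using assms by (intro add.subgroupI) auto
  then show ?thesis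
    using assms(4) by (simp add: left_ideal_def additive_subgroup_def)
qed

lemma left_idealD:
  assumes "left_ideal I R"
  shows "I \<subseteq> carrier R" "\<zero> \<in> I"
    and "a \<in> I \<Longrightarrow> b \<in> I \<Longrightarrow> a \<oplus> b \<in> I"
    and "a \<in> I \<Longrightarrow> x \<in> carrier R \<Longrightarrow> x \<otimes> a \<in> I"
proof -
  interpret additive_subgroup I R using assms by (simp add: left_ideal_def)
  show "I \<subseteq> carrier R" "\<zero> \<in> I" "a \<in> I \<Longrightarrow> b \<in> I \<Longrightarrow> a \<oplus> b \<in> I"
    using a_subset by auto
  show "a \<in> I \<Longrightarrow> x \<in> carrier R \<Longrightarrow> x \<otimes> a \<in> I"
    using assms by (simp add: left_ideal_def)
qed

lemma left_ideal_one_imp_carrier: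
  assumes "left_ideal I R" "\<one> \<in> I"
  shows "I = carrier R"
proof
  show "I \<subseteq> carrier R" by (rule left_idealD[OF assms(1)])
  show "carrier R \<subseteq> I"
    using left_idealD(4)[OF assms] by fastforce
qed

lemma left_ideal_principal:
  assumes "x \<in> carrier R"
  shows "left_ideal ((\<lambda>r. r \<otimes> x) ` carrier R) R"
proof (rule left_idealI)
  show "\<zero> \<in> (\<lambda>r. r \<otimes> x) ` carrier R"
    using assms by (auto intro!: image_eqI[of _ _ \<zero>])
  show "a \<oplus> b \<in> (\<lambda>r. r \<otimes> x) ` carrier R"
    if "a \<in> (\<lambda>r. r \<otimes> x) ` carrier R" "b \<in> (\<lambda>r. r \<otimes> x) ` carrier R" for a b
    using that assms by (auto simp flip: l_distr)
  show "y \<otimes> a \<in> (\<lambda>r. r \<otimes> x) ` carrier R"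
    if "a \<in> (\<lambda>r. r \<otimes> x) ` carrier R" "y \<in> carrier R" for a y
    using that assms by (auto simp flip: m_assoc)
qed (use assms in auto)

lemma left_ideal_sum:
  assumes "left_ideal I R" "left_ideal K R"
  shows "left_ideal {a \<oplus> b |a b. a \<in> I \<and> b \<in> K} R"
proof (rule left_idealI)
  note I = left_idealD[OF assms(1)] and K = left_idealD[OF assms(2)]
  show "{a \<oplus> b |a b. a \<in> I \<and> b \<in> K} \<subseteq> carrier R"
    using I(1) K(1) by auto
  show "\<zero> \<in> {a \<oplus> b |a b. a \<in> I \<and> b \<in> K}"
    using I(2) K(2) by force
  show "u \<oplus> v \<in> {a \<oplus> b |a b. a \<in> I \<and> b \<in> K}"
    if uv: "u \<in> {a \<oplus> b |a b. a \<in> I \<and> b \<in> K}" "v \<in> {a \<oplus> b |a b. a \<in> I \<and> b \<in> K}" for u v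
  proof -
    from uv obtain a b c d where u: "u = a \<oplus> b" "a \<in> I" "b \<in> K"
      and v: "v = c \<oplus> d" "c \<in> I" "d \<in> K" by blast
    have "a \<in> carrier R" "b \<in> carrier R" "c \<in> carrier R" "d \<in> carrier R"
      using u v I(1) K(1) by auto
    then have "u \<oplus> v = (a \<oplus> c) \<oplus> (b \<oplus> d)" unfolding u v by algebra
    moreover have "a \<oplus> c \<in> I" "b \<oplus> d \<in> K" using I(3) K(3) u v by auto
    ultimately show ?thesis by blast
  qed
  show "x \<otimes> u \<in> {a \<oplus> b |a b. a \<in> I \<and> b \<in> K}"
    if u: "u \<in> {a \<oplus> b |a b. a \<in> I \<and> b \<in> K}" and x: "x \<in> carrier R" for u x
  proof -
    from u obtain a b where ab: "u = a \<oplus> b" "a \<in> I" "b \<in> K" by blast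
    then have "a \<in> carrier R" "b \<in> carrier R" using I(1) K(1) by auto
    then have "x \<otimes> u = x \<otimes> a \<oplus> x \<otimes> b" using ab x by (simp add: r_distr)
    moreover have "x \<otimes> a \<in> I" "x \<otimes> b \<in> K" using I(4) K(4) ab x by auto
    ultimately show ?thesis by blast
  qed
qed

lemma left_ideal_Union_chain:
  assumes ne: "C \<noteq> {}" and C: "subset.chain {I. left_ideal I R \<and> \<one> \<notin> I} C"
  shows "left_ideal (\<Union>C) R"
proof -
  have li: "left_ideal I R" if "I \<in> C" for I
    using C that by (auto simp: subset.chain_def)
  show ?thesis
  proof (rule left_idealI)
    show "\<Union>C \<subseteq> carrier R" using left_idealD(1)[OF li] by auto
    show "\<zero> \<in> \<Union>C" using left_idealD(2)[OF li] ne by auto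
    show "a \<oplus> b \<in> \<Union>C" if a: "a \<in> \<Union>C" and b: "b \<in> \<Union>C" for a b
    proof -
      from a b obtain I K where IK: "I \<in> C" "a \<in> I" "K \<in> C" "b \<in> K" by blast
      then have "I \<subseteq> K \<or> K \<subseteq> I" using C by (auto simp: subset_chain_def)
      then show ?thesis
        using IK left_idealD(3)[OF li, of I a b] left_idealD(3)[OF li, of K a b] by blast
    qed
    show "x \<otimes> a \<in> \<Union>C" if a: "a \<in> \<Union>C" and x: "x \<in> carrier R" for a x
      using a left_idealD(4)[OF li _ x] by blast
  qed
qed

lemma exists_maximal_left_ideal:
  assumes I: "left_ideal I R" "\<one> \<notin> I"
  obtains M where "maximal_left_ideal M R" "I \<subseteq> M"
proof -
  \<comment> \<open>Properness is expressed by \<open>\<one> \<notin> K\<close> because, unlike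
    \<open>K \<noteq> carrier R\<close>, this passes to unions of chains at sight.\<close>
  let ?A = "{K. left_ideal K R \<and> \<one> \<notin> K}"
  let ?B = "{K \<in> ?A. I \<subseteq> K}"
  have "\<exists>M\<in>?B. \<forall>X\<in>?B. M \<subseteq> X \<longrightarrow> X = M"
  proof (rule subset_Zorn_nonempty)
    show "?B \<noteq> {}" using I by auto
    fix C assume C: "C \<noteq> {}" "subset.chain ?B C"
    then have sub: "C \<subseteq> ?B" and "subset.chain ?A C"
      by (auto simp: subset_chain_def)
    with C(1) have "left_ideal (\<Union>C) R" by (rule_tac left_ideal_Union_chain)
    moreover have "\<one> \<notin> \<Union>C" "I \<subseteq> \<Union>C" using sub C(1) by auto
    ultimately show "\<Union>C \<in> ?B" by simp
  qed
  then obtain M where M: "M \<in> ?B" and max: "\<forall>X\<in>?B. M \<subseteq> X \<longrightarrow> X = M" ..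
  have "maximal_left_ideal M R"
    unfolding maximal_left_ideal_def
  proof (intro conjI allI impI)
    show "left_ideal M R" "M \<noteq> carrier R" using M by auto
    fix K assume K: "left_ideal K R \<and> M \<subseteq> K"
    then show "K = M \<or> K = carrier R"
      using max M left_ideal_one_imp_carrier[of K] by (cases "\<one> \<in> K") auto
  qed
  with M that show ?thesis by blast
qed

section \<open>The Jacobson radical in terms of left inverses\<close>

lemma jacobson_radical_left_ideal: "left_ideal (jacobson_radical R) R"
proof (rule left_idealI)
  show "jacobson_radical R \<subseteq> carrier R" by (auto simp: jacobson_radical_def)
qed (auto simp: jacobson_radical_def maximal_left_ideal_def left_idealD)

lemma jacobson_radical_closed: "x \<in> jacobson_radical R \<Longrightarrow> x \<in> carrier R"
  by (simp add: jacobson_radical_def)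

text \<open>If \<open>R(1 - x)\<close> were proper, a maximal left ideal above it would contain both
  \<open>1 - x\<close> and \<open>x\<close>, hence \<open>1\<close>.\<close>

lemma jacobson_radical_left_inverse:
  assumes x: "x \<in> jacobson_radical R"
  obtains t where "t \<in> carrier R" "t \<otimes> (\<one> \<ominus> x) = \<one>"
proof -
  have xc: "x \<in> carrier R" using x by (rule jacobson_radical_closed)
  let ?I = "(\<lambda>r. r \<otimes> (\<one> \<ominus> x)) ` carrier R"
  have li: "left_ideal ?I R" using xc by (intro left_ideal_principal) simp
  have "\<one> \<in> ?I"
  proof (rule ccontr)
    assume "\<one> \<notin> ?I"
    with li obtain M where M: "maximal_left_ideal M R" "?I \<subseteq> M"
      by (rule exists_maximal_left_ideal)
    then have li: "left_ideal M R" "M \<noteq> carrier R" by (auto simp: maximal_left_ideal_def)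
    have "x \<in> M" using x M by (auto simp: jacobson_radical_def)
    moreover have "\<one> \<ominus> x \<in> ?I" using xc by (auto intro!: image_eqI[of _ _ \<one>])
    ultimately have "(\<one> \<ominus> x) \<oplus> x \<in> M" using left_idealD(3)[OF li(1)] M(2) by blast
    moreover have "(\<one> \<ominus> x) \<oplus> x = \<one>" using xc by algebra
    ultimately show False using li left_ideal_one_imp_carrier by simp
  qed
  with that show ?thesis by force
qed

text \<open>A maximal left ideal \<open>M\<close> missing \<open>x\<close> satisfies
  \<open>M + Rx = R\<close>, so \<open>1 = m + sx\<close> with \<open>m\<close> in \<open>M\<close>;
  but then \<open>m = 1 - sx\<close> is left invertible and \<open>M\<close> contains
  \<open>1\<close>.\<close>

lemma jacobson_radicalI:
  assumes x: "x \<in> carrier R"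
    and inv: "\<And>s. s \<in> carrier R \<Longrightarrow> \<exists>t\<in>carrier R. t \<otimes> (\<one> \<ominus> s \<otimes> x) = \<one>"
  shows "x \<in> jacobson_radical R"
proof (rule ccontr)
  assume "x \<notin> jacobson_radical R"
  then obtain M where M: "maximal_left_ideal M R" "x \<notin> M"
    using x by (auto simp: jacobson_radical_def)
  then have li: "left_ideal M R" "M \<noteq> carrier R" by (auto simp: maximal_left_ideal_def)
  let ?P = "(\<lambda>r. r \<otimes> x) ` carrier R"
  let ?S = "{a \<oplus> b |a b. a \<in> M \<and> b \<in> ?P}"
  note P = left_ideal_principal[OF x]
  have S: "left_ideal ?S R" by (rule left_ideal_sum[OF li(1) P])
  have "M \<subseteq> ?S"
  proof
    fix m assume m: "m \<in> M"
    then have "m = m \<oplus> \<zero>" using left_idealD(1)[OF li(1)] by auto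
    with m left_idealD(2)[OF P] show "m \<in> ?S" by blast
  qed
  moreover have "x \<in> ?S"
  proof -
    have "x = \<zero> \<oplus> \<one> \<otimes> x" using x by simp
    then show ?thesis using left_idealD(2)[OF li(1)] by blast
  qed
  ultimately have "?S = carrier R"
    using M S unfolding maximal_left_ideal_def by blast
  then obtain m s where ms: "m \<in> M" "s \<in> carrier R" "\<one> = m \<oplus> s \<otimes> x"
    using one_closed by (smt (verit) mem_Collect_eq imageE)
  have mc: "m \<in> carrier R" using ms(1) left_idealD(1)[OF li(1)] by auto
  have "m = (m \<oplus> s \<otimes> x) \<ominus> s \<otimes> x" using mc ms(2) x by algebra
  then have "m = \<one> \<ominus> s \<otimes> x" using ms(3) by simp
  then obtain t where "t \<in> carrier R" "t \<otimes> m = \<one>" using inv ms(2) by blast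
  then have "\<one> \<in> M" using left_idealD(4)[OF li(1) ms(1)] by metis
  then show False using li left_ideal_one_imp_carrier by blast
qed

text \<open>The formula is suggested by the formal geometric series:
  \<open>1 + ba + baba + ...\<close> equals \<open>1 + b(1 + ab + ...)a\<close>, with
  \<open>t\<close> in place of the inner sum.\<close>

lemma left_inverse_one_minus_swap:
  assumes c: "a \<in> carrier R" "b \<in> carrier R" "t \<in> carrier R"
    and t: "t \<otimes> (\<one> \<ominus> a \<otimes> b) = \<one>"
  shows "(\<one> \<oplus> b \<otimes> t \<otimes> a) \<otimes> (\<one> \<ominus> b \<otimes> a) = \<one>"
proof -
  have "(\<one> \<oplus> b \<otimes> t \<otimes> a) \<otimes> (\<one> \<ominus> b \<otimes> a)
      = \<one> \<ominus> b \<otimes> a \<oplus> b \<otimes> (t \<otimes> (\<one> \<ominus> a \<otimes> b)) \<otimes> a"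
    using c by algebra
  also have "\<dots> = \<one>" unfolding t using c by algebra
  finally show ?thesis .
qed

lemma jacobson_radical_ideal: "ideal (jacobson_radical R) R"
proof (rule idealI)
  note J = jacobson_radical_left_ideal
  show "subgroup (jacobson_radical R) (add_monoid R)"
    using J by (simp add: left_ideal_def additive_subgroup_def)
  show "x \<otimes> a \<in> jacobson_radical R" if "a \<in> jacobson_radical R" "x \<in> carrier R" for a x
    using left_idealD(4)[OF J] that .
  show "a \<otimes> x \<in> jacobson_radical R" if a: "a \<in> jacobson_radical R" and x: "x \<in> carrier R" for a x
  proof (rule jacobson_radicalI)
    have ac: "a \<in> carrier R" using a by (rule jacobson_radical_closed)
    then show "a \<otimes> x \<in> carrier R" using x by simp
    fix s assume s: "s \<in> carrier R"
    \<comment> \<open>The swap obtains a left inverse of \<open>1 - (sa)x\<close> from one of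
      \<open>1 - x(sa)\<close>, and \<open>xsa\<close> is in the radical as a left multiple of
      \<open>a\<close>.\<close>
    have "x \<otimes> s \<otimes> a \<in> jacobson_radical R"
      using left_idealD(4)[OF J a] x s by simp
    then have "x \<otimes> (s \<otimes> a) \<in> jacobson_radical R" using x s ac by (simp add: m_assoc)
    then obtain t where t: "t \<in> carrier R" "t \<otimes> (\<one> \<ominus> x \<otimes> (s \<otimes> a)) = \<one>"
      by (rule jacobson_radical_left_inverse)
    have "(\<one> \<oplus> s \<otimes> a \<otimes> t \<otimes> x) \<otimes> (\<one> \<ominus> s \<otimes> a \<otimes> x) = \<one>"
      using left_inverse_one_minus_swap[of x "s \<otimes> a" t] t x s ac by simp
    then show "\<exists>t\<in>carrier R. t \<otimes> (\<one> \<ominus> s \<otimes> (a \<otimes> x)) = \<one>"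
      using t x s ac by (intro bexI[of _ "\<one> \<oplus> s \<otimes> a \<otimes> t \<otimes> x"]) (auto simp: m_assoc)
  qed
qed (rule ring_axioms)

text \<open>A left inverse \<open>t\<close> of \<open>1 - x\<close> equals \<open>1 + tx\<close>,
  again \<open>1\<close> minus an element of the radical, so \<open>t\<close> has a left inverse as
  well. It must agree with the right inverse \<open>1 - x\<close> of \<open>t\<close>.\<close>

lemma one_minus_jacobson_radical_Units:
  assumes x: "x \<in> jacobson_radical R"
  shows "\<one> \<ominus> x \<in> Units R"
proof -
  have xc: "x \<in> carrier R" using x by (rule jacobson_radical_closed)
  obtain t where t: "t \<in> carrier R" "t \<otimes> (\<one> \<ominus> x) = \<one>"
    using x by (rule jacobson_radical_left_inverse)
  let ?y = "\<ominus> (t \<otimes> x)"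
  have "(\<ominus> t) \<otimes> x \<in> jacobson_radical R"
    using left_idealD(4)[OF jacobson_radical_left_ideal x] t by simp
  then have "?y \<in> jacobson_radical R" using t xc by (simp add: l_minus)
  then obtain s where s: "s \<in> carrier R" "s \<otimes> (\<one> \<ominus> ?y) = \<one>"
    by (rule jacobson_radical_left_inverse)
  have "t = t \<otimes> (\<one> \<ominus> x) \<oplus> t \<otimes> x" using t(1) xc by algebra
  then have "t = \<one> \<oplus> t \<otimes> x" using t(2) by simp
  then have "\<one> \<ominus> ?y = t" using t xc by (simp add: minus_eq)
  then have st: "s \<otimes> t = \<one>" using s(2) by simp
  have "s = \<one> \<ominus> x" by (rule inv_unique[of s t]) (use s t st xc in auto)
  then show ?thesis using st t s by (auto simp: Units_def)
qed

section \<open>Nilpotents and units\<close>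

lemma one_minus_nilpotent_Units:
  assumes "p \<in> nilpotents R"
  shows "\<one> \<ominus> p \<in> Units R"
proof -
  have p: "p \<in> carrier R" using assms by (simp add: nilpotents_def)
  obtain n :: nat where n: "p [^] n = \<zero>" using assms by (auto simp: nilpotents_def)
  \<comment> \<open>The witness is the partial geometric sum \<open>1 + p + ... + p^(n-1)\<close>,
    grown by \<open>p [^] n\<close> in each step.\<close>
  have "\<exists>s\<in>carrier R. s \<otimes> (\<one> \<ominus> p) = \<one> \<ominus> p [^] n \<and> (\<one> \<ominus> p) \<otimes> s = \<one> \<ominus> p [^] n" for n :: nat
  proof (induction n)
    case 0
    show ?case using p by (intro bexI[of _ \<zero>]) (auto simp: minus_eq r_neg)
  next
    case (Suc n)
    then obtain s where s: "s \<in> carrier R" "s \<otimes> (\<one> \<ominus> p) = \<one> \<ominus> p [^] n"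
      "(\<one> \<ominus> p) \<otimes> s = \<one> \<ominus> p [^] n" by blast
    let ?q = "p [^] n"
    have q: "?q \<in> carrier R" using p by simp
    have comm: "p \<otimes> ?q = ?q \<otimes> p" using p nat_pow_comm[of p 1 n] by simp
    have "(s \<oplus> ?q) \<otimes> (\<one> \<ominus> p) = s \<otimes> (\<one> \<ominus> p) \<oplus> (?q \<ominus> ?q \<otimes> p)"
      "(\<one> \<ominus> p) \<otimes> (s \<oplus> ?q) = (\<one> \<ominus> p) \<otimes> s \<oplus> (?q \<ominus> p \<otimes> ?q)"
      using s(1) p q by algebra+
    moreover have "\<one> \<ominus> ?q \<oplus> (?q \<ominus> ?q \<otimes> p) = \<one> \<ominus> ?q \<otimes> p" using p q by algebra
    ultimately show ?case using s p q comm by (intro bexI[of _ "s \<oplus> ?q"]) auto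
  qed
  from this[of n] n show ?thesis using p
    by (auto simp: Units_def minus_eq)
qed

lemma uminus_nilpotent:
  assumes "p \<in> nilpotents R"
  shows "\<ominus> p \<in> nilpotents R"
proof -
  have p: "p \<in> carrier R" using assms by (simp add: nilpotents_def)
  obtain n :: nat where n: "p [^] n = \<zero>" using assms by (auto simp: nilpotents_def)
  \<comment> \<open>The disjunction stands in for the parity of \<open>n\<close>; both values vanish
    together with \<open>p [^] n\<close>.\<close>
  have "(\<ominus> p) [^] n = p [^] n \<or> (\<ominus> p) [^] n = \<ominus> (p [^] n)" for n :: nat
    by (induction n) (use p in \<open>auto simp: l_minus r_minus\<close>)
  then have "(\<ominus> p) [^] n = \<zero>" using n by (metis minus_zero)
  then show ?thesis using p by (auto simp: nilpotents_def)
qed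

lemma one_plus_nilpotent_Units:
  assumes "p \<in> nilpotents R"
  shows "\<one> \<oplus> p \<in> Units R"
proof -
  have "p \<in> carrier R" using assms by (simp add: nilpotents_def)
  then show ?thesis
    using one_minus_nilpotent_Units[OF uminus_nilpotent[OF assms]] by (simp add: minus_eq)
qed

lemma square_zero_nilpotent: "x \<in> carrier R \<Longrightarrow> x \<otimes> x = \<zero> \<Longrightarrow> x \<in> nilpotents R"
  unfolding nilpotents_def by (auto intro!: exI[of _ "2::nat"] simp: numeral_2_eq_2)

lemma zero_nilpotent: "\<zero> \<in> nilpotents R"
  by (rule square_zero_nilpotent) auto

section \<open>Clean elements and nil-clean decompositions\<close>

lemma one_minus_idempotent:
  assumes "e \<in> idempotents R"
  shows "\<one> \<ominus> e \<in> idempotents R"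
proof -
  have e: "e \<in> carrier R" "e \<otimes> e = e" using assms by (auto simp: idempotents_def)
  have "(\<one> \<ominus> e) \<otimes> (\<one> \<ominus> e) = \<one> \<ominus> e \<ominus> e \<oplus> e \<otimes> e" using e(1) by algebra
  also have "\<dots> = \<one> \<ominus> e" unfolding e(2) using e(1) by algebra
  finally show ?thesis using e by (simp add: idempotents_def)
qed

text \<open>The element \<open>2e - 1\<close> is its own inverse, and
  \<open>e = (2e - 1) + (1 - e)\<close>.\<close>

lemma idempotent_clean:
  assumes "e \<in> idempotents R"
  shows "clean_element R e"
proof -
  have e: "e \<in> carrier R" "e \<otimes> e = e" using assms by (auto simp: idempotents_def)
  let ?u = "e \<oplus> e \<ominus> \<one>"
  have "?u \<otimes> ?u = \<one> \<ominus> e \<ominus> e \<ominus> e \<ominus> e \<oplus> (e \<otimes> e \<oplus> e \<otimes> e \<oplus> e \<otimes> e \<oplus> e \<otimes> e)"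
    using e(1) by algebra
  also have "\<dots> = \<one>" unfolding e(2) using e(1) by algebra
  finally have "?u \<in> Units R" using e by (auto simp: Units_def)
  moreover have "e = ?u \<oplus> (\<one> \<ominus> e)" using e(1) by algebra
  ultimately show ?thesis
    using one_minus_idempotent[OF assms] unfolding clean_element_def by blast
qed

lemma unit_clean: "u \<in> Units R \<Longrightarrow> clean_element R u"
  unfolding clean_element_def idempotents_def
  by (intro bexI[of _ u] bexI[of _ \<zero>]) auto

lemma uniquely_nil_clean_elementD:
  assumes "uniquely_nil_clean_element R r"
    and "q \<in> nilpotents R" "e \<in> idempotents R" "r = q \<oplus> e"
    and "q' \<in> nilpotents R" "e' \<in> idempotents R" "r = q' \<oplus> e'"
  shows "e = e'" "q = q'"
proof -
  have "(q, e) = (q', e')"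
    using assms unfolding uniquely_nil_clean_element_def by (metis SigmaI fst_conv snd_conv)
  then show "e = e'" "q = q'" by auto
qed

lemma uniquely_nil_clean_elementE:
  assumes "uniquely_nil_clean_element R r"
  obtains q e where "q \<in> nilpotents R" "e \<in> idempotents R" "r = q \<oplus> e"
proof -
  obtain p where "p \<in> nilpotents R \<times> idempotents R \<and> r = fst p \<oplus> snd p"
    using assms unfolding uniquely_nil_clean_element_def by (elim ex1E)
  then show ?thesis using that[of "fst p" "snd p"] by (simp add: mem_Times_iff)
qed

section \<open>Central idempotents and unipotent units in CUNC-rings\<close>

text \<open>
  If \<open>e\<close> is idempotent and \<open>n\<close> is one of the square-zero elements \<open>er(1 - e)\<close>, \<open>(1 - e)re\<close>,
  then \<open>e + n\<close> is idempotent, so \<open>n + e\<close> and \<open>0 + (e + n)\<close> are two nil-clean decompositions.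
\<close>

lemma CUNC_ring_imp_abelian:
  assumes "CUNC_ring R"
  shows "abelian_ring R"
  unfolding abelian_ring_def
proof (intro ballI)
  fix e r assume ei: "e \<in> idempotents R" and r: "r \<in> carrier R"
  then have e: "e \<in> carrier R" "e \<otimes> e = e" by (auto simp: idempotents_def)
  have e2: "e \<otimes> (e \<otimes> y) = e \<otimes> y" if "y \<in> carrier R" for y
    using e that by (simp flip: m_assoc)
  \<comment> \<open>The condition \<open>en + ne = n\<close> covers both off-diagonal Peirce
    components: for \<open>er(1 - e)\<close> the products are \<open>n\<close> and \<open>0\<close>,
    for \<open>(1 - e)re\<close> they are \<open>0\<close> and \<open>n\<close>.\<close>
  have *: "n = \<zero>" if n: "n \<in> carrier R" "n \<otimes> n = \<zero>" and en: "e \<otimes> n \<oplus> n \<otimes> e = n" for n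
  proof -
    have "(e \<oplus> n) \<otimes> (e \<oplus> n) = e \<otimes> e \<oplus> (e \<otimes> n \<oplus> n \<otimes> e) \<oplus> n \<otimes> n"
      using e(1) n(1) by algebra
    also have "\<dots> = e \<oplus> n" unfolding n(2) en e(2) using e(1) n(1) by simp
    finally have f: "e \<oplus> n \<in> idempotents R" using e n by (simp add: idempotents_def)
    then have "uniquely_nil_clean_element R (e \<oplus> n)"
      using assms idempotent_clean e n unfolding CUNC_ring_def by simp
    then show "n = \<zero>"
      by (rule uniquely_nil_clean_elementD(2)[OF _ square_zero_nilpotent[OF n] ei _ zero_nilpotent f])
        (use e n in \<open>auto simp: a_comm\<close>)
  qed
  have "e \<otimes> r \<ominus> e \<otimes> r \<otimes> e = \<zero>"
  proof (rule *)
    show "(e \<otimes> r \<ominus> e \<otimes> r \<otimes> e) \<otimes> (e \<otimes> r \<ominus> e \<otimes> r \<otimes> e) = \<zero>"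
      using e r by (simp add: ring_simprules e2)
    show "e \<otimes> (e \<otimes> r \<ominus> e \<otimes> r \<otimes> e) \<oplus> (e \<otimes> r \<ominus> e \<otimes> r \<otimes> e) \<otimes> e = e \<otimes> r \<ominus> e \<otimes> r \<otimes> e"
      using e r by (simp add: ring_simprules e2)
  qed (use e r in simp)
  moreover have "r \<otimes> e \<ominus> e \<otimes> r \<otimes> e = \<zero>"
  proof (rule *)
    show "(r \<otimes> e \<ominus> e \<otimes> r \<otimes> e) \<otimes> (r \<otimes> e \<ominus> e \<otimes> r \<otimes> e) = \<zero>"
      using e r by (simp add: ring_simprules e2)
    show "e \<otimes> (r \<otimes> e \<ominus> e \<otimes> r \<otimes> e) \<oplus> (r \<otimes> e \<ominus> e \<otimes> r \<otimes> e) \<otimes> e = r \<otimes> e \<ominus> e \<otimes> r \<otimes> e"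
      using e r by (simp add: ring_simprules e2)
  qed (use e r in simp)
  ultimately have "e \<otimes> r = e \<otimes> r \<otimes> e" "r \<otimes> e = e \<otimes> r \<otimes> e"
    using e r by (auto intro!: eq_if_minus_eq_zero)
  then show "e \<otimes> r = r \<otimes> e" by simp
qed

text \<open>
  The hypothesis on \<open>t\<close> says that \<open>q\<close> is left invertible in the corner ring \<open>eR\<close>.
\<close>

lemma central_idempotent_eq_zero:
  assumes e: "e \<in> carrier R" and central: "\<And>x. x \<in> carrier R \<Longrightarrow> e \<otimes> x = x \<otimes> e"
    and q: "q \<in> nilpotents R" and t: "t \<in> carrier R" "t \<otimes> (q \<otimes> e) = e"
  shows "e = \<zero>"
proof -
  have qc: "q \<in> carrier R" using q by (simp add: nilpotents_def)
  obtain n :: nat where n: "q [^] n = \<zero>" using q by (auto simp: nilpotents_def)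
  have "t [^] n \<otimes> (q [^] n \<otimes> e) = e" for n :: nat
  proof (induction n)
    case 0
    then show ?case using e by simp
  next
    case (Suc n)
    have "t [^] Suc n \<otimes> (q [^] Suc n \<otimes> e) = t [^] n \<otimes> (t \<otimes> (q \<otimes> (q [^] n \<otimes> e)))"
      using t(1) qc e by (simp only: nat_pow_Suc2[OF qc], simp add: m_assoc)
    also have "\<dots> = t [^] n \<otimes> ((t \<otimes> (q \<otimes> e)) \<otimes> q [^] n)"
      using t(1) qc e central[of "q [^] n"] by (simp add: m_assoc)
    also have "\<dots> = t [^] n \<otimes> (q [^] n \<otimes> e)"
      using t qc e central[of "q [^] n"] by simp
    finally show ?case using Suc by simp
  qed
  from this[of n] show ?thesis using n t e by simp
qed

text \<open>Write \<open>u = q + e\<close> and \<open>f = 1 - e\<close>. Then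
  \<open>uf = qf\<close>, so the inverse of \<open>u\<close> inverts the nilpotent \<open>q\<close>
  in the corner \<open>fR\<close>; hence \<open>f = 0\<close> and \<open>e = 1\<close>.\<close>

lemma CUNC_ring_unit_unipotent:
  assumes "CUNC_ring R" and u: "u \<in> Units R"
  shows "u \<ominus> \<one> \<in> nilpotents R"
proof -
  have uc: "u \<in> carrier R" "inv u \<in> carrier R" using u by auto
  have "uniquely_nil_clean_element R u"
    using assms unit_clean uc unfolding CUNC_ring_def by simp
  then obtain q e where qe: "q \<in> nilpotents R" "e \<in> idempotents R" "u = q \<oplus> e"
    by (rule uniquely_nil_clean_elementE)
  let ?f = "\<one> \<ominus> e"
  have fi: "?f \<in> idempotents R" using qe(2) by (rule one_minus_idempotent)
  have c: "q \<in> carrier R" "e \<in> carrier R" "e \<otimes> e = e"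
    using qe by (auto simp: nilpotents_def idempotents_def)
  have "u \<otimes> ?f = q \<otimes> ?f \<oplus> (e \<ominus> e \<otimes> e)" unfolding qe(3) using c(1,2) by algebra
  then have uf: "u \<otimes> ?f = q \<otimes> ?f" using c by (simp add: minus_eq r_neg)
  have "?f = \<zero>"
  proof (rule central_idempotent_eq_zero[OF _ _ qe(1)])
    show "?f \<otimes> x = x \<otimes> ?f" if "x \<in> carrier R" for x
      using CUNC_ring_imp_abelian[OF assms(1)] fi that unfolding abelian_ring_def by blast
    show "inv u \<otimes> (q \<otimes> ?f) = ?f"
      using uc c u by (simp flip: uf add: m_assoc[symmetric])
  qed (use uc c in auto)
  then have "e = \<one>" using c eq_if_minus_eq_zero[of \<one> e] by simp
  moreover have "(q \<oplus> \<one>) \<ominus> \<one> = q" using c(1) by algebra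
  ultimately show ?thesis using qe by simp
qed

lemma CUNC_ring_nil_jacobson_radical:
  assumes "CUNC_ring R"
  shows "nil_ideal (jacobson_radical R) R"
  unfolding nil_ideal_def
proof (intro conjI ballI jacobson_radical_ideal)
  fix x assume x: "x \<in> jacobson_radical R"
  then have xc: "x \<in> carrier R" by (rule jacobson_radical_closed)
  have "(\<one> \<ominus> x) \<ominus> \<one> \<in> nilpotents R"
    using assms one_minus_jacobson_radical_Units[OF x] by (rule CUNC_ring_unit_unipotent)
  moreover have "(\<one> \<ominus> x) \<ominus> \<one> = \<ominus> x" using xc by algebra
  ultimately show "x \<in> nilpotents R" using uminus_nilpotent[of "\<ominus> x"] xc by simp
qed

text \<open>Abelian rings are Dedekind-finite: \<open>f = ba\<close> is idempotent, hence central,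
  and \<open>f = f(ab) = (af)b = (ab)(ab) = 1\<close>.\<close>

lemma abelian_ring_left_inverse_unit:
  assumes "abelian_ring R" and c: "a \<in> carrier R" "b \<in> carrier R" and ab: "a \<otimes> b = \<one>"
  shows "b \<in> Units R"
proof -
  let ?f = "b \<otimes> a"
  have "?f \<otimes> ?f = b \<otimes> (a \<otimes> b) \<otimes> a" using c by algebra
  then have "?f \<in> idempotents R" using c ab by (simp add: idempotents_def)
  then have f: "?f \<otimes> a = a \<otimes> ?f" using assms unfolding abelian_ring_def by blast
  have "?f = ?f \<otimes> (a \<otimes> b)" using c ab by simp
  also have "\<dots> = (?f \<otimes> a) \<otimes> b" using c by (simp add: m_assoc)
  also have "\<dots> = (a \<otimes> b) \<otimes> (a \<otimes> b)" unfolding f using c by algebra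
  finally have "?f = \<one>" using ab by simp
  then show ?thesis using c ab by (auto simp: Units_def)
qed

section \<open>Semipotent CUNC-rings modulo the radical\<close>

text \<open>
  If \<open>r\<^sup>2 - r \<notin> J(R)\<close> then some non-zero central idempotent is \<open>e = s(r\<^sup>2 - r)\<close>, so \<open>r\<close> and
  \<open>r - 1\<close> are left invertible in \<open>eR\<close>; but \<open>er + (1 - e)\<close> is a unit, hence unipotent,
  which makes \<open>e(r - 1)\<close> nilpotent.
\<close>

lemma semipotent_CUNC_ring_boolean_mod_radical:
  assumes sp: "semipotent_ring R" and cunc: "CUNC_ring R" and r: "r \<in> carrier R"
  shows "r \<otimes> r \<ominus> r \<in> jacobson_radical R"
proof (rule ccontr)
  let ?a = "r \<otimes> r \<ominus> r"
  let ?I = "(\<lambda>s. s \<otimes> ?a) ` carrier R"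
  assume "?a \<notin> jacobson_radical R"
  moreover have "?a \<in> ?I" using r by (auto intro!: image_eqI[of _ _ \<one>])
  moreover have "left_ideal ?I R" using r by (intro left_ideal_principal) simp
  ultimately obtain e where e: "e \<in> ?I" "e \<in> idempotents R" "e \<noteq> \<zero>"
    using sp unfolding semipotent_ring_def by blast
  from e(1) obtain s where s: "s \<in> carrier R" "s \<otimes> ?a = e" by auto
  have ec: "e \<in> carrier R" "e \<otimes> e = e" using e(2) by (auto simp: idempotents_def)
  note ab = CUNC_ring_imp_abelian[OF cunc]
  have central: "e \<otimes> x = x \<otimes> e" if "x \<in> carrier R" for x
    using ab e(2) that unfolding abelian_ring_def by blast
  \<comment> \<open>\<open>?w\<close> inverts \<open>r\<close> in \<open>eR\<close> because
    \<open>s(r - 1)r = e\<close>. Filling up with the identity \<open>1 - e\<close> of the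
    complementary corner makes \<open>?v\<close> a left inverse of \<open>?u\<close> in the whole
    ring.\<close>
  let ?f = "\<one> \<ominus> e" and ?w = "s \<otimes> (r \<ominus> \<one>)"
  let ?u = "r \<otimes> e \<oplus> ?f" and ?v = "?w \<otimes> e \<oplus> ?f"
  have f: "e \<otimes> ?f = \<zero>" "?f \<otimes> e = \<zero>" "?f \<otimes> ?f = ?f"
    using ec one_minus_idempotent[OF e(2)]
    by (auto simp: idempotents_def r_distr l_distr l_minus r_minus r_neg minus_eq)
  have wc: "?w \<in> carrier R" "?f \<in> carrier R" using s(1) r ec(1) by auto
  have "?f \<otimes> (r \<otimes> e) = (?f \<otimes> e) \<otimes> r" using central[OF r] wc r ec(1) by (simp add: m_assoc)
  then have fr: "?f \<otimes> (r \<otimes> e) = \<zero>" using f(2) r by simp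
  have "?w \<otimes> e \<otimes> (r \<otimes> e) = ?w \<otimes> (e \<otimes> (e \<otimes> r))"
    using central[OF r] wc r ec(1) by (simp add: m_assoc)
  also have "e \<otimes> (e \<otimes> r) = r \<otimes> e"
    using central[OF r] ec r by (metis m_assoc)
  also have "?w \<otimes> (r \<otimes> e) = (s \<otimes> ?a) \<otimes> e" using s(1) r ec(1) by algebra
  finally have we: "?w \<otimes> e \<otimes> (r \<otimes> e) = e" using s(2) ec by simp
  have "?v \<otimes> ?u = (?w \<otimes> e \<otimes> (r \<otimes> e) \<oplus> ?w \<otimes> (e \<otimes> ?f)) \<oplus> (?f \<otimes> (r \<otimes> e) \<oplus> ?f \<otimes> ?f)"
    using wc r ec(1) by (simp add: l_distr r_distr m_assoc a_ac)
  also have "\<dots> = e \<oplus> ?f" unfolding we fr f using wc ec(1) by simp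
  also have "\<dots> = \<one>" using ec(1) by algebra
  finally have "?u \<in> Units R"
    using abelian_ring_left_inverse_unit[OF ab, of ?v ?u] s(1) r ec(1) by simp
  with cunc have "?u \<ominus> \<one> \<in> nilpotents R" by (rule CUNC_ring_unit_unipotent)
  moreover have "?u \<ominus> \<one> = (r \<ominus> \<one>) \<otimes> e" using r ec(1) by algebra
  ultimately have nil: "(r \<ominus> \<one>) \<otimes> e \<in> nilpotents R" by simp
  have "e = \<zero>"
  proof (rule central_idempotent_eq_zero[OF ec(1) central nil])
    \<comment> \<open>The factors of \<open>r^2 - r\<close> are now taken in the other order:
      \<open>sr\<close> inverts the nilpotent \<open>(r - 1)e\<close> in \<open>eR\<close>.\<close>
    have "s \<otimes> r \<otimes> ((r \<ominus> \<one>) \<otimes> e \<otimes> e) = (s \<otimes> ?a) \<otimes> (e \<otimes> e)" using s(1) r ec(1) by algebra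
    then show "s \<otimes> r \<otimes> ((r \<ominus> \<one>) \<otimes> e \<otimes> e) = e" using s(2) ec(2) by simp
  qed (use s r in auto)
  with e(3) show False by simp
qed

lemma boolean_ring_Quot_iff:
  assumes "ideal I R"
  shows "boolean_ring (R Quot I) \<longleftrightarrow> (\<forall>r\<in>carrier R. r \<otimes> r \<ominus> r \<in> I)"
proof -
  interpret I: ideal I R by (rule assms)
  have "(I +> r) \<otimes>\<^bsub>R Quot I\<^esub> (I +> r) = I +> r \<longleftrightarrow> r \<otimes> r \<ominus> r \<in> I" if "r \<in> carrier R" for r
    using that quotient_eq_iff_same_a_r_cos[OF assms, of "r \<otimes> r" r]
    by (simp add: FactRing_def I.rcoset_mult_add)
  moreover have "(I +> r) \<in> carrier (R Quot I)" if "r \<in> carrier R" for r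
    using that by (auto simp: FactRing_def A_RCOSETS_def')
  ultimately show ?thesis
    using I.quotient_is_ring
    by (auto simp: boolean_ring_def idempotents_def FactRing_simps)
qed

section \<open>From uniquely nil-clean to semipotent\<close>

lemma uniquely_nil_clean_imp_CUNC: "uniquely_nil_clean_ring R \<Longrightarrow> CUNC_ring R"
  by (simp add: uniquely_nil_clean_ring_def CUNC_ring_def)

text \<open>
  If \<open>x \<in> I - J(R)\<close>, some multiple \<open>y = p + e\<close> of \<open>x\<close> in \<open>I\<close> has \<open>1 - y\<close> not left invertible, which
  rules out \<open>e = 0\<close>; and \<open>ye = (1 + p)e\<close> with \<open>1 + p\<close> a unit puts \<open>e\<close> into \<open>I\<close>.
\<close>

lemma uniquely_nil_clean_imp_semipotent:
  assumes unc: "uniquely_nil_clean_ring R"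
  shows "semipotent_ring R"
  unfolding semipotent_ring_def
proof (intro allI impI)
  fix I assume I: "(left_ideal I R \<or> right_ideal I R) \<and> \<not> I \<subseteq> jacobson_radical R"
  have Ic: "I \<subseteq> carrier R"
    using I by (auto simp: left_ideal_def right_ideal_def dest: additive_subgroup.a_subset)
  obtain x where x: "x \<in> I" "x \<notin> jacobson_radical R" using I by blast
  then have xc: "x \<in> carrier R" using Ic by blast
  obtain s where s: "s \<in> carrier R" and noinv: "\<And>t. t \<in> carrier R \<Longrightarrow> t \<otimes> (\<one> \<ominus> s \<otimes> x) \<noteq> \<one>"
    using jacobson_radicalI[OF xc] x(2) by blast
  \<comment> \<open>The same \<open>s\<close> serves on the other side by the swap of
    \<open>1 - xs\<close> and \<open>1 - sx\<close>. This is what brings right ideals within reach,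
    since they contain \<open>xs\<close> rather than \<open>sx\<close>.\<close>
  have noinv': "t \<otimes> (\<one> \<ominus> x \<otimes> s) \<noteq> \<one>" if t: "t \<in> carrier R" for t
    using left_inverse_one_minus_swap[OF xc s t] noinv[of "\<one> \<oplus> s \<otimes> t \<otimes> x"] t xc s by auto
  obtain y where y: "y \<in> I" "\<And>t. t \<in> carrier R \<Longrightarrow> t \<otimes> (\<one> \<ominus> y) \<noteq> \<one>"
  proof (cases "left_ideal I R")
    case True
    then show ?thesis using that[of "s \<otimes> x"] noinv x s by (auto simp: left_ideal_def)
  next
    case False
    then show ?thesis using that[of "x \<otimes> s"] noinv' x s I by (auto simp: right_ideal_def)
  qed
  have yc: "y \<in> carrier R" using y Ic by blast
  then have "uniquely_nil_clean_element R y" using unc by (simp add: uniquely_nil_clean_ring_def)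
  then obtain p e where pe: "p \<in> nilpotents R" "e \<in> idempotents R" "y = p \<oplus> e"
    by (rule uniquely_nil_clean_elementE)
  have c: "p \<in> carrier R" "e \<in> carrier R" "e \<otimes> e = e"
    using pe by (auto simp: nilpotents_def idempotents_def)
  have central: "e \<otimes> z = z \<otimes> e" if "z \<in> carrier R" for z
    using CUNC_ring_imp_abelian[OF uniquely_nil_clean_imp_CUNC[OF unc]] pe(2) that
    unfolding abelian_ring_def by blast
  have "e \<noteq> \<zero>"
  proof
    assume "e = \<zero>"
    then have "y = p" using pe(3) c by simp
    then have "\<one> \<ominus> y \<in> Units R" using one_minus_nilpotent_Units pe(1) by simp
    then show False using y(2)[of "inv (\<one> \<ominus> y)"] by simp
  qed
  moreover have "e \<in> I"
  proof -
    let ?u = "\<one> \<oplus> p"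
    have u: "?u \<in> Units R" using pe(1) by (rule one_plus_nilpotent_Units)
    have uc: "?u \<in> carrier R" "inv ?u \<in> carrier R" using u by auto
    have "y \<otimes> e = ?u \<otimes> e \<oplus> (e \<otimes> e \<ominus> e)" unfolding pe(3) using c(1,2) by algebra
    then have ye: "y \<otimes> e = ?u \<otimes> e" using c by (simp add: minus_eq r_neg)
    \<comment> \<open>Centrality gives \<open>e\<close> both as a left multiple of \<open>y\<close>,
      for left ideals, and as a right multiple, for right ideals.\<close>
    have "(inv ?u \<otimes> e) \<otimes> y = inv ?u \<otimes> (y \<otimes> e)"
      using central[OF yc] uc c yc by (simp add: m_assoc)
    also have "\<dots> = e" unfolding ye using u uc c by (simp flip: m_assoc)
    finally have 1: "(inv ?u \<otimes> e) \<otimes> y = e" .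
    have "y \<otimes> (e \<otimes> inv ?u) = (y \<otimes> e) \<otimes> inv ?u" using uc c yc by (simp add: m_assoc)
    also have "\<dots> = (e \<otimes> ?u) \<otimes> inv ?u" unfolding ye central[OF uc(1)] ..
    also have "\<dots> = e" using u uc c by (simp add: m_assoc)
    finally have 2: "y \<otimes> (e \<otimes> inv ?u) = e" .
    show ?thesis
    proof (cases "left_ideal I R")
      case True
      then show ?thesis using left_idealD(4)[OF True y(1), of "inv ?u \<otimes> e"] 1 uc c by simp
    next
      case False
      then have "right_ideal I R" using I by blast
      then have "y \<otimes> (e \<otimes> inv ?u) \<in> I" using y(1) uc c unfolding right_ideal_def by blast
      then show ?thesis using 2 by simp
    qed
  qed
  ultimately show "\<exists>e\<in>I. e \<in> idempotents R \<and> e \<noteq> \<zero>" using pe(2) by blast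
qed

section \<open>Lifting idempotents modulo a nil ideal\<close>

text \<open>
  Idempotents lift modulo a nil ideal by Newton iteration for \<open>x\<^sup>2 - x\<close>: the step
  \<open>x \<mapsto> 3x\<^sup>2 - 2x\<^sup>3\<close> makes \<open>x(1 - x)\<close> a multiple of its square.
\<close>

lemma lift_idempotent_power:
  assumes "ideal I R" and "x \<in> carrier R"
    and "x \<otimes> (\<one> \<ominus> x) \<in> I" and "(x \<otimes> (\<one> \<ominus> x)) [^] ((2::nat) ^ k) = \<zero>"
  shows "\<exists>e\<in>idempotents R. x \<ominus> e \<in> I"
  using assms(2-)
proof (induction k arbitrary: x)
  case 0
  interpret I: ideal I R by (rule assms)
  have "x \<otimes> x = x \<ominus> x \<otimes> (\<one> \<ominus> x)" using 0(1) by algebra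
  also have "\<dots> = x" using 0 by (simp add: minus_eq)
  finally show ?case
    using 0(1) by (intro bexI[of _ x]) (auto simp: idempotents_def minus_eq r_neg)
next
  case (Suc k)
  interpret I: ideal I R by (rule assms)
  note x = Suc.prems(1)
  \<comment> \<open>Here \<open>p = 3 - 2x\<close> and \<open>q = 3 - 2y\<close>, so
    \<open>?z\<close> is the Newton step. Exchanging \<open>x\<close> and \<open>y\<close> turns
    \<open>?z\<close> into \<open>y^2 q\<close>, which is \<open>1 - ?z\<close>. All of these are
    polynomials in \<open>x\<close> and commute, so \<open>?z(1 - ?z) = (xy)^2 pq\<close>.\<close>
  define y p q where "y = \<one> \<ominus> x" and "p = \<one> \<oplus> y \<oplus> y" and "q = \<one> \<oplus> x \<oplus> x"
  let ?a = "x \<otimes> y" and ?z = "x \<otimes> x \<otimes> p" and ?c = "p \<otimes> q"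
  have c: "y \<in> carrier R" "p \<in> carrier R" "q \<in> carrier R"
    using x by (auto simp: y_def p_def q_def)
  have prod_comm: "(u \<otimes> v) \<otimes> w = w \<otimes> (u \<otimes> v)"
    if "u \<otimes> w = w \<otimes> u" "v \<otimes> w = w \<otimes> v" "u \<in> carrier R" "v \<in> carrier R" "w \<in> carrier R" for u v w
    using that by (metis m_assoc)
  have xy: "x \<otimes> y = y \<otimes> x" "x \<otimes> q = q \<otimes> x"
    using x unfolding y_def q_def by algebra+
  have "x \<otimes> p = x \<oplus> x \<otimes> y \<oplus> x \<otimes> y" "p \<otimes> x = x \<oplus> y \<otimes> x \<oplus> y \<otimes> x"
    "y \<otimes> q = y \<oplus> y \<otimes> x \<oplus> y \<otimes> x" "q \<otimes> y = y \<oplus> x \<otimes> y \<oplus> x \<otimes> y"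
    "y \<otimes> p = p \<otimes> y"
    using x c(1) unfolding p_def q_def by algebra+
  with xy have xp: "x \<otimes> p = p \<otimes> x" and yq: "y \<otimes> q = q \<otimes> y" and yp: "y \<otimes> p = p \<otimes> y"
    by simp_all
  have ac: "?a \<in> carrier R" "?c \<in> carrier R" using x c by auto
  have "?a \<otimes> p = p \<otimes> ?a" "?a \<otimes> q = q \<otimes> ?a"
    using prod_comm xp xy yp yq x c by auto
  then have "?a \<otimes> ?c = ?c \<otimes> ?a" using prod_comm[of p ?a q] x c by simp
  then have comm: "(?a \<otimes> ?a) \<otimes> ?c = ?c \<otimes> (?a \<otimes> ?a)" using prod_comm ac by blast
  have "\<one> \<ominus> ?z = y \<otimes> y \<otimes> q" using x unfolding y_def p_def q_def by algebra
  then have "?z \<otimes> (\<one> \<ominus> ?z) = x \<otimes> (x \<otimes> (p \<otimes> (y \<otimes> y))) \<otimes> q"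
    using x c by (simp add: m_assoc)
  also have "p \<otimes> (y \<otimes> y) = (y \<otimes> y) \<otimes> p" using prod_comm[of y p y] yp c by simp
  also have "x \<otimes> (x \<otimes> ((y \<otimes> y) \<otimes> p)) \<otimes> q = x \<otimes> (?a \<otimes> y) \<otimes> ?c"
    using x c by (simp add: m_assoc)
  also have "?a \<otimes> y = y \<otimes> ?a" using xy x c by (simp add: m_assoc)
  also have "x \<otimes> (y \<otimes> ?a) \<otimes> ?c = (?a \<otimes> ?a) \<otimes> ?c" using x c by (simp add: m_assoc)
  finally have z: "?z \<otimes> (\<one> \<ominus> ?z) = (?a \<otimes> ?a) \<otimes> ?c" .
  note IH_prems = Suc.prems(2,3)[folded y_def]
  have "(?a \<otimes> ?a) [^] ((2::nat) ^ k) = ?a [^] ((2::nat) ^ Suc k)"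
    using nat_pow_pow[OF ac(1), of 2 "2 ^ k"] ac by (simp add: numeral_2_eq_2)
  then have "((?a \<otimes> ?a) \<otimes> ?c) [^] ((2::nat) ^ k) = \<zero>"
    using pow_mult_distrib[OF comm] IH_prems(2) ac by simp
  then have "(?z \<otimes> (\<one> \<ominus> ?z)) [^] ((2::nat) ^ k) = \<zero>" unfolding z .
  moreover have "?z \<otimes> (\<one> \<ominus> ?z) \<in> I" unfolding z using IH_prems(1) ac
    by (auto intro!: I.I_r_closed)
  ultimately obtain e where e: "e \<in> idempotents R" "?z \<ominus> e \<in> I"
    using Suc.IH[of ?z] x c by blast
  have ec: "e \<in> carrier R" using e by (simp add: idempotents_def)
  \<comment> \<open>The factor \<open>x(1 - x)\<close> keeps the iteration inside the coset of
    \<open>x\<close> modulo \<open>I\<close>, so the idempotent found for \<open>?z\<close> also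
    serves \<open>x\<close>.\<close>
  have "x \<ominus> ?z = ?a \<otimes> (\<one> \<ominus> x \<ominus> x)" using x unfolding y_def p_def by algebra
  then have "x \<ominus> ?z \<in> I" using IH_prems(1) x by (auto intro!: I.I_r_closed)
  then have "(x \<ominus> ?z) \<oplus> (?z \<ominus> e) \<in> I" using e by simp
  moreover have "(x \<ominus> ?z) \<oplus> (?z \<ominus> e) = x \<ominus> e" using x c ec by algebra
  ultimately show ?case using e by auto
qed

lemma lift_idempotent:
  assumes I: "nil_ideal I R" and x: "x \<in> carrier R" "x \<otimes> x \<ominus> x \<in> I"
  obtains e where "e \<in> idempotents R" "x \<ominus> e \<in> I"
proof -
  interpret I: ideal I R using I by (simp add: nil_ideal_def)
  have "x \<otimes> (\<one> \<ominus> x) = \<ominus> (x \<otimes> x \<ominus> x)" using x(1) by algebra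
  then have a: "x \<otimes> (\<one> \<ominus> x) \<in> I" using x by simp
  let ?a = "x \<otimes> (\<one> \<ominus> x)"
  have ac: "?a \<in> carrier R" using x by simp
  obtain n :: nat where n: "?a [^] n = \<zero>"
    using a I unfolding nil_ideal_def nilpotents_def by blast
  \<comment> \<open>Each Newton step squares \<open>x(1 - x)\<close> up to a factor and so halves
    the exponent that kills it. Hence the exponent \<open>n\<close> is enlarged to a power of
    two.\<close>
  have "n \<le> 2 ^ n" by (simp add: less_imp_le)
  then have "?a [^] ((2::nat) ^ n) = ?a [^] n \<otimes> ?a [^] (2 ^ n - n)"
    using nat_pow_mult[OF ac, of n "2 ^ n - n"] by simp
  then have "?a [^] ((2::nat) ^ n) = \<zero>" using n ac by simp
  from lift_idempotent_power[OF I.is_ideal x(1) a this] show ?thesis using that by blast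
qed

section \<open>Uniqueness and existence of nil-clean decompositions\<close>

text \<open>
  With \<open>f = e(1 - e')\<close>, multiplying \<open>q + e = q' + e'\<close> by \<open>f\<close> gives \<open>q'f = (1 + q)f\<close>, so
  \<open>q'\<close> is left invertible in \<open>fR\<close> and \<open>f = 0\<close>.
\<close>

lemma abelian_ring_nil_clean_le:
  assumes ab: "abelian_ring R"
    and qe: "q \<in> nilpotents R" "e \<in> idempotents R"
    and qe': "q' \<in> nilpotents R" "e' \<in> idempotents R" and eq: "q \<oplus> e = q' \<oplus> e'"
  shows "e = e \<otimes> e'"
proof -
  have c: "q \<in> carrier R" "e \<in> carrier R" "q' \<in> carrier R" "e' \<in> carrier R"
    and ee: "e \<otimes> e = e" "e' \<otimes> e' = e'"
    using qe qe' by (auto simp: nilpotents_def idempotents_def)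
  have central: "e \<otimes> x = x \<otimes> e" "e' \<otimes> x = x \<otimes> e'" if "x \<in> carrier R" for x
    using ab qe qe' that unfolding abelian_ring_def by blast+
  let ?f = "e \<otimes> (\<one> \<ominus> e')"
  let ?u = "\<one> \<oplus> q"
  have u: "?u \<in> Units R" using qe(1) by (rule one_plus_nilpotent_Units)
  have uc: "inv ?u \<in> carrier R" using u by auto
  have ee': "e' \<otimes> e = e \<otimes> e'" using central(1)[OF c(4)] by simp
  have e'f: "e' \<otimes> ?f = \<zero>"
  proof -
    have "e' \<otimes> ?f = (e' \<otimes> e) \<ominus> (e' \<otimes> e) \<otimes> e'" using c by algebra
    also have "\<dots> = e \<otimes> e' \<ominus> e \<otimes> (e' \<otimes> e')" unfolding ee' using c by (simp add: m_assoc)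
    also have "\<dots> = \<zero>" unfolding ee using c by (simp add: minus_eq r_neg)
    finally show ?thesis .
  qed
  have ef: "e \<otimes> ?f = ?f" using c ee by (simp flip: m_assoc)
  have "q' \<otimes> ?f = (q' \<oplus> e') \<otimes> ?f \<ominus> e' \<otimes> ?f" using c by algebra
  also have "\<dots> = (q \<oplus> e) \<otimes> ?f" unfolding e'f eq using c by (simp add: minus_eq)
  also have "\<dots> = q \<otimes> ?f \<oplus> e \<otimes> ?f" using c by (simp add: l_distr)
  also have "\<dots> = ?u \<otimes> ?f" unfolding ef using c by algebra
  finally have qf: "q' \<otimes> ?f = ?u \<otimes> ?f" .
  have "?f = \<zero>"
  proof (rule central_idempotent_eq_zero[OF _ _ qe'(1) uc])
    show "inv ?u \<otimes> (q' \<otimes> ?f) = ?f" unfolding qf using u uc c by (simp flip: m_assoc)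
    fix x assume x: "x \<in> carrier R"
    have "?f \<otimes> x = e \<otimes> x \<ominus> e \<otimes> (e' \<otimes> x)" using x c by algebra
    also have "\<dots> = x \<otimes> e \<ominus> (e \<otimes> x) \<otimes> e'"
      unfolding central[OF x] using x c by (simp add: m_assoc flip: central(1))
    also have "\<dots> = x \<otimes> ?f" unfolding central[OF x] using x c by algebra
    finally show "?f \<otimes> x = x \<otimes> ?f" .
  qed (use c in simp)
  moreover have "e = ?f \<oplus> e \<otimes> e'" using c by algebra
  ultimately show ?thesis using c by simp
qed

text \<open>For commuting idempotents \<open>e = ee'\<close> is the order \<open>e \<le> e'\<close>.
  The situation is symmetric in the two decompositions, so the order holds both ways and
  antisymmetry applies.\<close>

lemma abelian_ring_nil_clean_unique:
  assumes ab: "abelian_ring R"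
    and qe: "q \<in> nilpotents R" "e \<in> idempotents R"
    and qe': "q' \<in> nilpotents R" "e' \<in> idempotents R" and eq: "q \<oplus> e = q' \<oplus> e'"
  shows "e = e'" "q = q'"
proof -
  have c: "q \<in> carrier R" "e \<in> carrier R" "q' \<in> carrier R" "e' \<in> carrier R"
    using qe qe' by (auto simp: nilpotents_def idempotents_def)
  have "e = e \<otimes> e'" using assms by (rule abelian_ring_nil_clean_le)
  also have "\<dots> = e' \<otimes> e" using ab qe c unfolding abelian_ring_def by blast
  also have "\<dots> = e'" using abelian_ring_nil_clean_le[OF ab qe' qe] eq by simp
  finally show "e = e'" .
  with eq c show "q = q'" by (simp add: add.right_cancel)
qed

text \<open>Existence: \<open>r\<close> is idempotent modulo the radical, and a lifted idempotent
  \<open>e\<close> leaves the difference \<open>r - e\<close> in the radical, which is nil.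
  Uniqueness comes from centrality.\<close>

lemma abelian_nil_boolean_imp_uniquely_nil_clean:
  assumes ab: "abelian_ring R" and nil: "nil_ideal (jacobson_radical R) R"
    and bool: "boolean_ring (R Quot (jacobson_radical R))"
  shows "uniquely_nil_clean_ring R"
  unfolding uniquely_nil_clean_ring_def
proof
  fix r assume r: "r \<in> carrier R"
  then have "r \<otimes> r \<ominus> r \<in> jacobson_radical R"
    using bool boolean_ring_Quot_iff[OF jacobson_radical_ideal] by blast
  then obtain e where e: "e \<in> idempotents R" "r \<ominus> e \<in> jacobson_radical R"
    by (rule lift_idempotent[OF nil r])
  have q: "r \<ominus> e \<in> nilpotents R" using nil e(2) by (simp add: nil_ideal_def)
  have ec: "e \<in> carrier R" using e by (simp add: idempotents_def)
  have req: "r = (r \<ominus> e) \<oplus> e" using r ec by algebra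
  show "uniquely_nil_clean_element R r"
    unfolding uniquely_nil_clean_element_def
  proof (rule ex1I[of _ "(r \<ominus> e, e)"])
    show "(r \<ominus> e, e) \<in> nilpotents R \<times> idempotents R \<and> r = fst (r \<ominus> e, e) \<oplus> snd (r \<ominus> e, e)"
      using q e req by simp
    fix p assume p: "p \<in> nilpotents R \<times> idempotents R \<and> r = fst p \<oplus> snd p"
    then have "fst p \<in> nilpotents R" "snd p \<in> idempotents R" "fst p \<oplus> snd p = (r \<ominus> e) \<oplus> e"
      using req by auto
    from abelian_ring_nil_clean_unique[OF ab this(1,2) q e(1) this(3)]
    show "p = (r \<ominus> e, e)" by (simp add: prod_eq_iff)
  qed
qed

end

theorem theorem3p7:
  fixes R :: "('a, 'b) ring_scheme"
  assumes "ring R"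
  shows "(uniquely_nil_clean_ring R \<longleftrightarrow> semipotent_ring R \<and> CUNC_ring R)
       \<and> (semipotent_ring R \<and> CUNC_ring R \<longleftrightarrow>
            abelian_ring R \<and> nil_ideal (jacobson_radical R) R
            \<and> boolean_ring (R Quot (jacobson_radical R)))"
proof -
  interpret ring R by (rule assms)
  have "semipotent_ring R \<and> CUNC_ring R" if "uniquely_nil_clean_ring R"
    using that uniquely_nil_clean_imp_semipotent uniquely_nil_clean_imp_CUNC by blast
  moreover have "abelian_ring R \<and> nil_ideal (jacobson_radical R) R
      \<and> boolean_ring (R Quot (jacobson_radical R))" if "semipotent_ring R \<and> CUNC_ring R"
    using that CUNC_ring_imp_abelian CUNC_ring_nil_jacobson_radical
      semipotent_CUNC_ring_boolean_mod_radical boolean_ring_Quot_iff[OF jacobson_radical_ideal]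
    by blast
  ultimately show ?thesis
    using abelian_nil_boolean_imp_uniquely_nil_clean by blast
qed

end
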